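(* Let $f:\mathbb{R}_{>0}^n\to\mathbb{R}_{>0}^n$ be a monotone homogeneous map. If the two players do not have disjoint dominions in the game $\Gamma_\infty(f)$ (that is, there is no pair $(I,J)$ of disjoint subsets of $[n]$ with $I$ a dominion of player Min and $J$ a dominion of player Max), then $f$ has an eigenvector, i.e., there exist $u\in\mathbb{R}_{>0}^n$ and $\lambda>0$ such that $f(u)=\lambda u$.
   Context: $[n]=\{1,\dots,n\}$; $\mathbb{R}_{>0}^n$ is the set of vectors of $\mathbb{R}^n$ with all entries positive, with the componentwise order $\le$. A map $f:\mathbb{R}_{>0}^n\to\mathbb{R}_{>0}^n$ is monotone homogeneous if $x\le y\Rightarrow f(x)\le f(y)$ and $f(\lambda x)=\lambda f(x)$ for all $\lambda>0$. $f_i$ is the $i$th coordinate of $f$. For $K\subset[n]$, $e_K\in\mathbb{R}^n$ is the vector with entries $1$ on $K$ and $0$ elsewhere, $K^c=[n]\setminus K$, and $\exp:\mathbb{R}^n\to\mathbb{R}_{>0}^n$ acts componentwise. Game $\Gamma_\infty(f)$: the state space is $[n]$. In state $i$, the actions of player Min are the sets $I\subset[n]$ such that $\lim_{\alpha\to+\infty} f_i(\exp(\alpha e_{I^c}))<+\infty$, and the actions of player Max are the sets $J\subset[n]$ such that $\lim_{\alpha\to-\infty} f_i(\exp(\alpha e_{J^c}))>0$. At each stage the players choose simultaneously actions $I$ and $J$ and the next state is drawn uniformly in $I\cap J$ (which is never empty). A dominion of a player is a nonempty set $\Delta\subset[n]$ such that from any initial state in $\Delta$ that player can force the state to remain almost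 surely in $\Delta$ at every stage, whatever the other player does. Equivalently, a nonempty $\Delta$ is a dominion of a player if and only if, for every state $i\in\Delta$, the set $\Delta$ is itself an action of that player in state $i$. *)

theory Defs
  imports "HOL-Probability.Probability"
begin

definition pos_orthant :: "(real^'n) set" where
  "pos_orthant = {x. \<forall>i. 0 < x $ i}"

text \<open>The order on \<^typ>\<open>real^'n\<close> is componentwise.\<close>

definition monotone_homogeneous :: "(real^'n \<Rightarrow> real^'n) \<Rightarrow> bool" where
  "monotone_homogeneous f \<longleftrightarrow>
     f ` pos_orthant \<subseteq> pos_orthant \<and>
     mono_on pos_orthant f \<and>
     (\<forall>c>0. \<forall>x\<in>pos_orthant. f (c *\<^sub>R x) = c *\<^sub>R f x)"

definition vec_exp :: "real^'n \<Rightarrow> real^'n" where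
  "vec_exp x = (\<chi> i. exp (x $ i))"

definition ind_vec :: "'n set \<Rightarrow> real^'n" where
  "ind_vec K = (\<chi> i. if i \<in> K then 1 else 0)"

text \<open>The limits are taken in \<^typ>\<open>ereal\<close>; for monotone \<open>f\<close> they always exist
  (lemma \<open>action_limits_exist\<close> below), so \<^const>\<open>Lim\<close> is never a junk value.\<close>

definition min_actions :: "(real^'n \<Rightarrow> real^'n) \<Rightarrow> 'n \<Rightarrow> 'n set set" where
  "min_actions f i =
     {I. Lim at_top (\<lambda>\<alpha>. ereal (f (vec_exp (\<alpha> *\<^sub>R ind_vec (- I))) $ i)) < \<infinity>}"

definition max_actions :: "(real^'n \<Rightarrow> real^'n) \<Rightarrow> 'n \<Rightarrow> 'n set set" where
  "max_actions f i =
     {J. Lim at_bot (\<lambda>\<alpha>. ereal (f (vec_exp (\<alpha> *\<^sub>R ind_vec (- J))) $ i)) > 0}"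

text \<open>A history lists the past stages as (state, own action, opponent's action).
  A (behavioural) strategy maps the history and the current state to a distribution on actions;
  the two players randomize independently.\<close>

type_synonym 'n history = "('n \<times> 'n set \<times> 'n set) list"
type_synonym 'n strategy = "'n history \<Rightarrow> 'n \<Rightarrow> 'n set pmf"

definition strategies :: "('n \<Rightarrow> 'n set set) \<Rightarrow> 'n strategy set" where
  "strategies A = {\<sigma>. \<forall>h i. set_pmf (\<sigma> h i) \<subseteq> A i}"

text \<open>\<open>play \<sigma> \<tau> i k\<close> is the joint law of the history and the state after \<open>k\<close> stages, starting
  from \<open>i\<close>. The set \<open>I \<inter> J\<close> is nonempty for legal actions (lemma \<open>actions_inter_nonempty\<close>).\<close>

primrec play :: "'n strategy \<Rightarrow> 'n strategy \<Rightarrow> 'n \<Rightarrow> nat \<Rightarrow> ('n history \<times> 'n) pmf" where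
  "play \<sigma> \<tau> i 0 = return_pmf ([], i)"
| "play \<sigma> \<tau> i (Suc k) =
     bind_pmf (play \<sigma> \<tau> i k) (\<lambda>(h, s).
       bind_pmf (pair_pmf (\<sigma> h s) (\<tau> h s)) (\<lambda>(I, J).
         map_pmf (\<lambda>s'. (h @ [(s, I, J)], s')) (pmf_of_set (I \<inter> J))))"

text \<open>\<open>A\<close> gives the actions of the player owning the dominion, \<open>B\<close> those of the opponent.
  As there are countably many stages, remaining in \<open>D\<close> almost surely at each stage is the same as
  almost surely remaining in \<open>D\<close> forever.\<close>

definition dominion :: "('n \<Rightarrow> 'n set set) \<Rightarrow> ('n \<Rightarrow> 'n set set) \<Rightarrow> 'n set \<Rightarrow> bool" where
  "dominion A B D \<longleftrightarrow> D \<noteq> {} \<and>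
     (\<forall>i\<in>D. \<exists>\<sigma>\<in>strategies A. \<forall>\<tau>\<in>strategies B.
        \<forall>k. AE (h, s) in play \<sigma> \<tau> i k. s \<in> D)"

definition min_dominion :: "(real^'n \<Rightarrow> real^'n) \<Rightarrow> 'n set \<Rightarrow> bool" where
  "min_dominion f = dominion (min_actions f) (max_actions f)"

definition max_dominion :: "(real^'n \<Rightarrow> real^'n) \<Rightarrow> 'n set \<Rightarrow> bool" where
  "max_dominion f = dominion (max_actions f) (min_actions f)"

lemma action_path_mono:
  assumes "monotone_homogeneous f" "a \<le> b" "K \<subseteq> L" "\<And>j. j \<in> L - K \<Longrightarrow> 0 \<le> b"
  shows "f (vec_exp (a *\<^sub>R ind_vec K)) $ i \<le> f (vec_exp (b *\<^sub>R ind_vec L)) $ i"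
proof -
  have "vec_exp (a *\<^sub>R ind_vec K) \<le> vec_exp (b *\<^sub>R ind_vec L)"
    using assms(2-4) by (auto simp: vec_exp_def ind_vec_def less_eq_vec_def)
  moreover have "vec_exp x \<in> pos_orthant" for x :: "real^'a"
    by (simp add: vec_exp_def pos_orthant_def)
  ultimately show ?thesis
    using assms(1) unfolding monotone_homogeneous_def
    by (metis less_eq_vec_def mono_onD)
qed

lemma action_limits_exist:
  assumes "monotone_homogeneous f"
  shows "((\<lambda>\<alpha>. ereal (f (vec_exp (\<alpha> *\<^sub>R ind_vec K)) $ i)) \<longlongrightarrow>
            (SUP \<alpha>. ereal (f (vec_exp (\<alpha> *\<^sub>R ind_vec K)) $ i))) at_top" (is ?A)
    and "((\<lambda>\<alpha>. ereal (f (vec_exp (\<alpha> *\<^sub>R ind_vec K)) $ i)) \<longlongrightarrow>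
            (INF \<alpha>. ereal (f (vec_exp (\<alpha> *\<^sub>R ind_vec K)) $ i))) at_bot" (is ?B)
proof -
  let ?g = "\<lambda>\<alpha>::real. ereal (f (vec_exp (\<alpha> *\<^sub>R ind_vec K)) $ i)"
  have m: "?g a \<le> ?g b" if "a \<le> b" for a b
    using action_path_mono[OF assms that, of K K i] by simp
  show ?A
  proof (rule order_tendstoI)
    fix y assume "y < (SUP \<alpha>. ?g \<alpha>)"
    then obtain a where "y < ?g a" by (auto simp: less_SUP_iff)
    then show "\<forall>\<^sub>F x in at_top. y < ?g x"
      using m unfolding eventually_at_top_linorder by (meson less_le_trans)
  next
    fix y assume "(SUP \<alpha>. ?g \<alpha>) < y"
    then show "\<forall>\<^sub>F x in at_top. ?g x < y"
      by (intro always_eventually allI) (meson SUP_upper UNIV_I le_less_trans)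
  qed
  show ?B
  proof (rule order_tendstoI)
    fix y assume "(INF \<alpha>. ?g \<alpha>) < y"
    then obtain a where "?g a < y" by (auto simp: INF_less_iff)
    then show "\<forall>\<^sub>F x in at_bot. ?g x < y"
      using m unfolding eventually_at_bot_linorder by (meson le_less_trans)
  next
    fix y assume "y < (INF \<alpha>. ?g \<alpha>)"
    then show "\<forall>\<^sub>F x in at_bot. y < ?g x"
      by (intro always_eventually allI) (meson INF_lower UNIV_I less_le_trans)
  qed
qed

lemma min_actions_iff:
  assumes "monotone_homogeneous f"
  shows "I \<in> min_actions f i \<longleftrightarrow> (\<exists>C. \<forall>\<alpha>. f (vec_exp (\<alpha> *\<^sub>R ind_vec (- I))) $ i \<le> C)"
proof -
  let ?g = "\<lambda>\<alpha>::real. f (vec_exp (\<alpha> *\<^sub>R ind_vec (- I))) $ i"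
  have "Lim at_top (\<lambda>\<alpha>. ereal (?g \<alpha>)) = (SUP \<alpha>. ereal (?g \<alpha>))"
    using action_limits_exist(1)[OF assms] by (intro tendsto_Lim) auto
  then have "I \<in> min_actions f i \<longleftrightarrow> (SUP \<alpha>. ereal (?g \<alpha>)) < \<infinity>"
    by (simp add: min_actions_def)
  also have "\<dots> \<longleftrightarrow> (\<exists>C. \<forall>\<alpha>. ?g \<alpha> \<le> C)"
  proof
    assume *: "(SUP \<alpha>. ereal (?g \<alpha>)) < \<infinity>"
    have "ereal (?g 0) \<le> (SUP \<alpha>. ereal (?g \<alpha>))" by (rule SUP_upper) simp
    with * obtain C where C: "(SUP \<alpha>. ereal (?g \<alpha>)) = ereal C"
      by (cases "SUP \<alpha>. ereal (?g \<alpha>)") auto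
    have "ereal (?g \<alpha>) \<le> ereal C" for \<alpha>
      unfolding C[symmetric] by (rule SUP_upper) simp
    then show "\<exists>C. \<forall>\<alpha>. ?g \<alpha> \<le> C" by auto
  next
    assume "\<exists>C. \<forall>\<alpha>. ?g \<alpha> \<le> C"
    then obtain C where "\<And>\<alpha>. ?g \<alpha> \<le> C" by blast
    then have "(SUP \<alpha>. ereal (?g \<alpha>)) \<le> ereal C" by (intro SUP_least) auto
    then show "(SUP \<alpha>. ereal (?g \<alpha>)) < \<infinity>" by (auto intro: le_less_trans)
  qed
  finally show ?thesis .
qed

lemma max_actions_iff:
  assumes "monotone_homogeneous f"
  shows "J \<in> max_actions f i \<longleftrightarrow> (\<exists>c>0. \<forall>\<alpha>. c \<le> f (vec_exp (\<alpha> *\<^sub>R ind_vec (- J))) $ i)"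
proof -
  let ?g = "\<lambda>\<alpha>::real. f (vec_exp (\<alpha> *\<^sub>R ind_vec (- J))) $ i"
  have "Lim at_bot (\<lambda>\<alpha>. ereal (?g \<alpha>)) = (INF \<alpha>. ereal (?g \<alpha>))"
    using action_limits_exist(2)[OF assms] by (intro tendsto_Lim) auto
  then have "J \<in> max_actions f i \<longleftrightarrow> 0 < (INF \<alpha>. ereal (?g \<alpha>))"
    by (simp add: max_actions_def)
  also have "\<dots> \<longleftrightarrow> (\<exists>c>0. \<forall>\<alpha>. c \<le> ?g \<alpha>)"
  proof
    assume *: "0 < (INF \<alpha>. ereal (?g \<alpha>))"
    have "(INF \<alpha>. ereal (?g \<alpha>)) \<le> ereal (?g 0)" by (rule INF_lower) simp
    with * obtain c where c: "(INF \<alpha>. ereal (?g \<alpha>)) = ereal c"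
      by (cases "INF \<alpha>. ereal (?g \<alpha>)") auto
    have "ereal c \<le> ereal (?g \<alpha>)" for \<alpha>
      unfolding c[symmetric] by (rule INF_lower) simp
    then show "\<exists>c>0. \<forall>\<alpha>. c \<le> ?g \<alpha>" using * c by auto
  next
    assume "\<exists>c>0. \<forall>\<alpha>. c \<le> ?g \<alpha>"
    then obtain c where "c > 0" "\<And>\<alpha>. c \<le> ?g \<alpha>" by blast
    then have "ereal c \<le> (INF \<alpha>. ereal (?g \<alpha>))" by (intro INF_greatest) auto
    then show "0 < (INF \<alpha>. ereal (?g \<alpha>))" using \<open>c > 0\<close>
      by (metis ereal_less(2) less_le_trans)
  qed
  finally show ?thesis .
qed

lemma actions_inter_nonempty:
  assumes f: "monotone_homogeneous f" and I: "I \<in> min_actions f i" and J: "J \<in> max_actions f i"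
  shows "I \<inter> J \<noteq> {}"
proof
  assume "I \<inter> J = {}"
  then have sub: "J \<subseteq> - I" by blast
  obtain C where C: "\<And>\<alpha>. f (vec_exp (\<alpha> *\<^sub>R ind_vec (- I))) $ i \<le> C"
    using I min_actions_iff[OF f] by blast
  obtain c where c: "c > 0" "\<And>\<alpha>. c \<le> f (vec_exp (\<alpha> *\<^sub>R ind_vec (- J))) $ i"
    using J max_actions_iff[OF f] by blast
  have bound: "exp \<alpha> * c \<le> C" if "\<alpha> \<ge> 0" for \<alpha> :: real
  proof -
    have eq: "vec_exp (\<alpha> *\<^sub>R ind_vec J) = exp \<alpha> *\<^sub>R vec_exp ((- \<alpha>) *\<^sub>R ind_vec (- J))"
      by (simp add: vec_exp_def ind_vec_def vec_eq_iff exp_minus)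
    have "vec_exp ((- \<alpha>) *\<^sub>R ind_vec (- J)) \<in> pos_orthant"
      by (simp add: vec_exp_def pos_orthant_def)
    then have "f (vec_exp (\<alpha> *\<^sub>R ind_vec J)) =
               exp \<alpha> *\<^sub>R f (vec_exp ((- \<alpha>) *\<^sub>R ind_vec (- J)))"
      unfolding eq using f unfolding monotone_homogeneous_def by (metis exp_gt_zero)
    then have "exp \<alpha> * c \<le> f (vec_exp (\<alpha> *\<^sub>R ind_vec J)) $ i"
      using c(2)[of "- \<alpha>"] by simp
    also have "\<dots> \<le> C"
      using action_path_mono[OF f order_refl sub] that C order_trans by metis
    finally show ?thesis .
  qed
  have "C / c \<ge> 0" using bound[of 0] c(1) by (auto intro!: divide_nonneg_pos)
  moreover have "exp (C / c) > C / c" by (metis exp_ge_add_one_self less_add_one less_le_trans add.commute)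
  ultimately show False using bound[of "C / c"] c(1) by (simp add: field_simps)
qed

lemma UNIV_action:
  assumes "monotone_homogeneous f"
  shows "UNIV \<in> min_actions f i" "UNIV \<in> max_actions f i"
proof -
  have z: "\<alpha> *\<^sub>R ind_vec (- UNIV) = (0 :: real^'a)" for \<alpha>
    by (simp add: ind_vec_def vec_eq_iff)
  have "0 < f (vec_exp 0) $ i"
    using assms by (auto simp: monotone_homogeneous_def pos_orthant_def vec_exp_def image_subset_iff)
  then show "UNIV \<in> min_actions f i" "UNIV \<in> max_actions f i"
    unfolding min_actions_iff[OF assms] max_actions_iff[OF assms] z by blast+
qed

lemma actions_upward_closed:
  assumes f: "monotone_homogeneous f" and "I \<subseteq> D"
  shows "I \<in> min_actions f i \<Longrightarrow> D \<in> min_actions f i"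
    and "I \<in> max_actions f i \<Longrightarrow> D \<in> max_actions f i"
proof -
  have sub: "- D \<subseteq> - I" using assms(2) by blast
  assume "I \<in> min_actions f i"
  then obtain C where C: "\<And>\<alpha>. f (vec_exp (\<alpha> *\<^sub>R ind_vec (- I))) $ i \<le> C"
    unfolding min_actions_iff[OF f] by blast
  have "f (vec_exp (\<alpha> *\<^sub>R ind_vec (- D))) $ i \<le> C" for \<alpha>
    using action_path_mono[OF f _ sub, of \<alpha> "max \<alpha> 0" i] C[of "max \<alpha> 0"] by force
  then show "D \<in> min_actions f i" unfolding min_actions_iff[OF f] by blast
next
  assume "I \<in> max_actions f i"
  then obtain c where c: "c > 0" "\<And>\<alpha>. c \<le> f (vec_exp (\<alpha> *\<^sub>R ind_vec (- I))) $ i"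
    unfolding max_actions_iff[OF f] by blast
  have "c \<le> f (vec_exp (\<alpha> *\<^sub>R ind_vec (- D))) $ i" for \<alpha>
  proof -
    have "vec_exp (min \<alpha> 0 *\<^sub>R ind_vec (- I)) \<le> vec_exp (\<alpha> *\<^sub>R ind_vec (- D))"
      using assms(2) by (auto simp: vec_exp_def ind_vec_def less_eq_vec_def)
    then have "f (vec_exp (min \<alpha> 0 *\<^sub>R ind_vec (- I))) $ i \<le> f (vec_exp (\<alpha> *\<^sub>R ind_vec (- D))) $ i"
      using f unfolding monotone_homogeneous_def mono_on_def
      by (auto simp: vec_exp_def pos_orthant_def less_eq_vec_def)
    with c(2)[of "min \<alpha> 0"] show ?thesis by linarith
  qed
  with c(1) show "D \<in> max_actions f i" unfolding max_actions_iff[OF f] by blast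
qed

lemma dominion_iff:
  fixes A B :: "'n::finite \<Rightarrow> 'n set set"
  assumes ne: "\<And>i I J. I \<in> A i \<Longrightarrow> J \<in> B i \<Longrightarrow> I \<inter> J \<noteq> {}"
    and U: "\<And>i. UNIV \<in> B i"
    and up: "\<And>i I D. I \<in> A i \<Longrightarrow> I \<subseteq> D \<Longrightarrow> D \<in> A i"
    and UA: "\<And>i. UNIV \<in> A i"
  shows "dominion A B D \<longleftrightarrow> D \<noteq> {} \<and> (\<forall>i\<in>D. D \<in> A i)"
proof (intro iffI conjI ballI)
  assume dom: "dominion A B D"
  then show "D \<noteq> {}" by (simp add: dominion_def)
  fix i assume "i \<in> D"
  with dom obtain \<sigma> where \<sigma>: "\<sigma> \<in> strategies A"
    "\<forall>\<tau>\<in>strategies B. \<forall>k. AE (h, s) in play \<sigma> \<tau> i k. s \<in> D"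
    unfolding dominion_def by blast
  have "(\<lambda>h i. return_pmf UNIV) \<in> strategies B" using U by (simp add: strategies_def)
  with \<sigma>(2) have "AE (h, s) in play \<sigma> (\<lambda>h i. return_pmf UNIV) i (Suc 0). s \<in> D" by blast
  then have 1: "s \<in> D" if "(h, s) \<in> set_pmf (play \<sigma> (\<lambda>h i. return_pmf UNIV) i (Suc 0))" for h s
    using that by (auto simp: AE_measure_pmf_iff)
  obtain I where I: "I \<in> set_pmf (\<sigma> [] i)" using set_pmf_not_empty by fast
  then have IA: "I \<in> A i" using \<sigma>(1) by (auto simp: strategies_def)
  then have "I \<noteq> {}" using ne[OF IA U] by simp
  have "s \<in> D" if "s \<in> I" for s
  proof (rule 1)
    have "\<exists>x\<in>set_pmf (\<sigma> [] i). ([(i, I, UNIV)], s) \<in> Pair [(i, x, UNIV)] ` set_pmf (pmf_of_set x)"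
      by (rule bexI[OF _ I]) (use \<open>I \<noteq> {}\<close> that in simp)
    then show "([(i, I, UNIV)], s) \<in> set_pmf (play \<sigma> (\<lambda>h i. return_pmf UNIV) i (Suc 0))"
      by simp
  qed
  then have "I \<subseteq> D" by blast
  with up IA show "D \<in> A i" by blast
next
  assume D: "D \<noteq> {} \<and> (\<forall>i\<in>D. D \<in> A i)"
  define \<sigma> :: "'n strategy" where "\<sigma> = (\<lambda>h i. return_pmf (if i \<in> D then D else UNIV))"
  have \<sigma>: "\<sigma> \<in> strategies A" using D UA by (auto simp: strategies_def \<sigma>_def)
  have "\<forall>x\<in>set_pmf (play \<sigma> \<tau> i k). snd x \<in> D" if "i \<in> D" "\<tau> \<in> strategies B" for i \<tau> k
  proof (induction k)
    case (Suc k)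
    show ?case
    proof
      fix x assume "x \<in> set_pmf (play \<sigma> \<tau> i (Suc k))"
      then obtain h s J where *: "(h, s) \<in> set_pmf (play \<sigma> \<tau> i k)" "J \<in> set_pmf (\<tau> h s)"
        "snd x \<in> set_pmf (pmf_of_set ((if s \<in> D then D else UNIV) \<inter> J))"
        by (auto simp: \<sigma>_def simp del: set_pmf_of_set)
      have "s \<in> D" using Suc *(1) by auto
      moreover have "J \<in> B s" using *(2) \<open>\<tau> \<in> strategies B\<close> by (auto simp: strategies_def)
      ultimately have "D \<inter> J \<noteq> {}" using ne D by blast
      then show "snd x \<in> D" using *(3) \<open>s \<in> D\<close> by simp
    qed
  qed (use that in simp)
  then have "\<forall>i\<in>D. \<exists>\<sigma>\<in>strategies A. \<forall>\<tau>\<in>strategies B. \<forall>k. AE (h, s) in play \<sigma> \<tau> i k. s \<in> D"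
    using \<sigma> by (intro ballI bexI[of _ \<sigma>]) (auto simp: AE_measure_pmf_iff split_def)
  with D show "dominion A B D" by (simp add: dominion_def)
qed

lemma min_dominion_iff:
  fixes f :: "real^'n::finite \<Rightarrow> real^'n"
  assumes f: "monotone_homogeneous f"
  shows "min_dominion f D \<longleftrightarrow> D \<noteq> {} \<and> (\<forall>i\<in>D. D \<in> min_actions f i)"
  unfolding min_dominion_def
proof (rule dominion_iff)
  show "I \<inter> J \<noteq> {}" if "I \<in> min_actions f i" "J \<in> max_actions f i" for i I J
    using actions_inter_nonempty[OF f] that by blast
qed (use UNIV_action[OF f] actions_upward_closed(1)[OF f] in blast)+

lemma max_dominion_iff:
  fixes f :: "real^'n::finite \<Rightarrow> real^'n"
  assumes f: "monotone_homogeneous f"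
  shows "max_dominion f D \<longleftrightarrow> D \<noteq> {} \<and> (\<forall>i\<in>D. D \<in> max_actions f i)"
  unfolding max_dominion_def
proof (rule dominion_iff)
  show "I \<inter> J \<noteq> {}" if "I \<in> max_actions f i" "J \<in> min_actions f i" for i I J
    using actions_inter_nonempty[OF f] that by (metis Int_commute)
qed (use UNIV_action[OF f] actions_upward_closed(2)[OF f] in blast)+

end

theory Submission
  imports Defs
begin

text \<open>Put \<open>T = log \<circ> f \<circ> exp\<close>. Monotonicity and homogeneity of \<open>f\<close> make \<open>T\<close> monotone and
  commuting with the addition of constant vectors, and \<open>f\<close> has an eigenvector iff \<open>T z - z\<close> is
  constant for some \<open>z\<close>. Two facts produce such a \<open>z\<close>.

  The game enters through an a priori bound: without disjoint dominions, the vectors \<open>y\<close> with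
  \<open>- M \<le> T y - y \<le> M\<close> have bounded oscillation (\<open>slice_oscillation_bounded\<close>). Indeed, let
  \<open>T y \<le> y + M\<close> and let \<open>D\<close> be the set of indices at which \<open>y\<close> is at most \<open>t\<close> above its minimum.
  If \<open>D\<close> is not a dominion of Min, then some coordinate \<open>i \<in> D\<close> of \<open>T\<close> is pushed above any bound
  by raising the entries outside \<open>D\<close>, so these entries cannot all be far above the minimum of \<open>y\<close>.
  Hence a larger threshold, independent of \<open>y\<close>, gives a strictly larger set. After at most \<open>n\<close>
  enlargements a dominion of Min is reached on which \<open>y\<close> is close to its minimum
  (\<open>min_closed_near_minimum\<close>). Applied to \<open>x \<mapsto> - T (- x)\<close>, the same argument gives a dominion of
  Max on which \<open>y\<close> is close to its maximum. The two dominions share a state, which bounds the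
  oscillation.

  Independently of the game, for \<open>0 < \<epsilon> < 1\<close> the map \<open>x \<mapsto> T ((1 - \<epsilon>) x)\<close> sends a large cube
  into itself, hence has a fixed point \<open>x\<close> by Brouwer. The vector \<open>y = (1 - \<epsilon>) x\<close> satisfies
  \<open>T y - y = \<epsilon> x\<close>, which is bounded uniformly in \<open>\<epsilon>\<close> because the cube has size \<open>O(1/\<epsilon>)\<close>. The a
  priori bound thus controls the oscillation of \<open>y\<close>, and \<open>T y - y = \<epsilon>/(1 - \<epsilon>) y\<close> has oscillation
  \<open>O(\<epsilon>)\<close>. After a translation all these \<open>y\<close> lie in one compact cube, on which the oscillation of
  \<open>T y - y\<close> attains its infimum, which is \<open>0\<close>.\<close>

section \<open>Monotone maps commuting with constants\<close>

definition topical :: "(real^'n \<Rightarrow> real^'n) \<Rightarrow> bool" where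
  "topical T \<longleftrightarrow> mono T \<and> (\<forall>x c. T (x + vec c) = T x + vec c)"

lemma topical_mono: "topical T \<Longrightarrow> x \<le> y \<Longrightarrow> T x $ i \<le> T y $ i"
  by (auto simp: topical_def mono_def less_eq_vec_def)

lemma topical_add_const: "topical T \<Longrightarrow> T (x + vec c) $ i = T x $ i + c"
  by (simp add: topical_def)

lemma topical_const: "topical T \<Longrightarrow> T (vec c) $ i = T 0 $ i + c"
  using topical_add_const[of T 0 c i] by simp

lemma topical_dual:
  assumes "topical T"
  shows "topical (\<lambda>x. - T (- x))"
proof -
  have "- T (- (x + vec c)) = - T (- x) + vec c" for x c
  proof -
    have "- (x + vec c) = - x + vec (- c)" by (simp add: vec_eq_iff)
    then have "T (- (x + vec c)) $ i = T (- x) $ i - c" for i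
      by (simp only: topical_add_const[OF assms])
    then show ?thesis by (simp add: vec_eq_iff del: minus_add_distrib)
  qed
  moreover have "mono (\<lambda>x. - T (- x))"
    using assms by (auto simp: topical_def mono_def less_eq_vec_def)
  ultimately show ?thesis by (simp add: topical_def)
qed

text \<open>Sandwiching \<open>x\<close> between the translates of \<open>y\<close> by \<open>\<plusminus> \<parallel>x - y\<parallel>\<close> shows that each coordinate
  of \<open>T\<close> is nonexpansive.\<close>

lemma topical_nonexpansive:
  fixes T :: "real^'n::finite \<Rightarrow> real^'n"
  assumes "topical T"
  shows "\<bar>T x $ i - T y $ i\<bar> \<le> norm (x - y)"
proof -
  have *: "T x $ i \<le> T y $ i + norm (x - y)" for x y
  proof -
    have "x $ j - y $ j \<le> norm (x - y)" for j
      using component_le_norm_cart[of "x - y" j] by simp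
    then have "x \<le> y + vec (norm (x - y))" by (simp add: less_eq_vec_def algebra_simps)
    from topical_mono[OF assms this, of i] show ?thesis by (simp add: topical_add_const[OF assms])
  qed
  from *[of x y] *[of y x] show ?thesis by (simp add: norm_minus_commute)
qed

lemma topical_continuous:
  fixes T :: "real^'n::finite \<Rightarrow> real^'n"
  assumes "topical T"
  shows "continuous_on S T"
proof -
  have "continuous_on S (\<lambda>x. T x $ i)" for i
  proof (rule continuous_onI)
    fix x e assume "0 < (e::real)"
    then show "\<exists>d>0. \<forall>x'\<in>S. dist x' x < d \<longrightarrow> dist (T x' $ i) (T x $ i) \<le> e"
      using order_trans[OF topical_nonexpansive[OF assms] less_imp_le]
      by (intro exI[of _ e]) (auto simp: dist_norm)
  qed
  then have "continuous_on S (\<lambda>x. \<chi> i. T x $ i)" by (rule continuous_on_vec_lambda)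
  then show ?thesis by simp
qed

section \<open>Dominions and bounded slices\<close>

text \<open>For \<open>T = log \<circ> f \<circ> exp\<close>, the nonempty sets with this property are the dominions of Min. Those
  of Max are obtained by applying it to \<open>x \<mapsto> - T (- x)\<close>.\<close>

definition min_closed :: "(real^'n \<Rightarrow> real^'n) \<Rightarrow> 'n set \<Rightarrow> bool" where
  "min_closed T D \<longleftrightarrow> (\<forall>i\<in>D. \<exists>C. \<forall>\<alpha>. T (\<alpha> *\<^sub>R ind_vec (- D)) $ i \<le> C)"

lemma not_min_closed_uniform:
  fixes T :: "real^'n::finite \<Rightarrow> real^'n"
  assumes T: "topical T"
  shows "\<exists>G. \<forall>D. \<not> min_closed T D \<longrightarrow> (\<exists>i\<in>D. K < T (G *\<^sub>R ind_vec (- D)) $ i)"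
proof -
  have "\<exists>\<alpha>. \<not> min_closed T D \<longrightarrow> (\<exists>i\<in>D. K < T (\<alpha> *\<^sub>R ind_vec (- D)) $ i)" for D
    unfolding min_closed_def by (meson not_less)
  then obtain a where a: "\<And>D. \<not> min_closed T D \<Longrightarrow> \<exists>i\<in>D. K < T (a D *\<^sub>R ind_vec (- D)) $ i"
    by metis
  let ?G = "Max (range a)"
  have "\<exists>i\<in>D. K < T (?G *\<^sub>R ind_vec (- D)) $ i" if nd: "\<not> min_closed T D" for D
  proof -
    have "a D \<le> ?G" by simp
    then have "a D *\<^sub>R ind_vec (- D) \<le> ?G *\<^sub>R (ind_vec (- D) :: real^'n)"
      by (simp add: less_eq_vec_def ind_vec_def)
    then show ?thesis using a[OF nd] topical_mono[OF T] less_le_trans by meson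
  qed
  then show ?thesis by blast
qed

definition near_min :: "real^'n \<Rightarrow> real \<Rightarrow> 'n set" where
  "near_min y t = {i. \<forall>j. y $ i \<le> y $ j + t}"

lemma near_min_mono: "s \<le> t \<Longrightarrow> near_min y s \<subseteq> near_min y t"
  by (auto simp: near_min_def) (meson add_left_mono order_trans)

lemma near_min_nonempty:
  fixes y :: "real^'n::finite"
  assumes "0 \<le> t"
  shows "near_min y t \<noteq> {}"
proof -
  have "Min (range (($) y)) \<in> range (($) y)" by (rule Min_in) auto
  then obtain i where i: "y $ i = Min (range (($) y))" by force
  have "y $ i \<le> y $ j" for j unfolding i by (rule Min_le) auto
  then have "y $ i \<le> y $ j + t" for j using assms by (rule add_increasing2[rotated])
  then show ?thesis by (auto simp: near_min_def)
qed

text \<open>One enlargement step: if no entry outside \<open>D = near_min y t\<close> were less than \<open>G\<close> above the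
  minimum, then \<open>y\<close> would dominate a translate of \<open>G *\<^sub>R ind_vec (- D)\<close>, whose image under \<open>T\<close> is
  too large to be compatible with \<open>T y \<le> y + M\<close>.\<close>

lemma near_min_grows:
  fixes T :: "real^'n::finite \<Rightarrow> real^'n"
  assumes T: "topical T"
  shows "\<exists>u\<ge>t. \<forall>y. T y \<le> y + vec M \<longrightarrow>
    min_closed T (near_min y t) \<or> near_min y t \<subset> near_min y u"
proof -
  obtain G where G: "\<And>D. \<not> min_closed T D \<Longrightarrow> \<exists>i\<in>D. M + t < T (G *\<^sub>R ind_vec (- D)) $ i"
    using not_min_closed_uniform[OF T] by blast
  have "near_min y t \<subset> near_min y (max t G)"
    if y: "T y \<le> y + vec M" and nc: "\<not> min_closed T (near_min y t)" for y
  proof -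
    let ?D = "near_min y t"
    obtain i where i: "i \<in> ?D" "M + t < T (G *\<^sub>R ind_vec (- ?D)) $ i" using G[OF nc] by blast
    have low: "y $ i - t \<le> y $ j" for j using i(1) by (simp add: near_min_def algebra_simps)
    have "\<exists>j. j \<notin> ?D \<and> y $ j < y $ i - t + G"
    proof (rule ccontr)
      assume "\<not> ?thesis"
      then have "G *\<^sub>R ind_vec (- ?D) + vec (y $ i - t) \<le> y"
        using low by (auto simp: less_eq_vec_def ind_vec_def not_less algebra_simps)
      from topical_mono[OF T this, of i]
      have "T (G *\<^sub>R ind_vec (- ?D)) $ i + (y $ i - t) \<le> T y $ i"
        by (simp only: topical_add_const[OF T])
      moreover have "T y $ i \<le> y $ i + M" using y by (simp add: less_eq_vec_def)
      ultimately show False using i(2) by simp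
    qed
    then obtain j where j: "j \<notin> ?D" "y $ j < y $ i - t + G" by blast
    have "y $ j \<le> y $ l + max t G" for l using low[of l] j(2) by linarith
    then have "j \<in> near_min y (max t G)" by (simp add: near_min_def)
    with j(1) near_min_mono[of t "max t G" y] show ?thesis by auto
  qed
  then show ?thesis by (intro exI[of _ "max t G"]) auto
qed

text \<open>Enlarging more than \<open>n\<close> times is impossible, so one of the thresholds met on the way, all of
  which are independent of \<open>y\<close>, cuts out a \<open>min_closed\<close> set.\<close>

lemma min_closed_near_minimum:
  fixes T :: "real^'n::finite \<Rightarrow> real^'n"
  assumes T: "topical T"
  shows "\<exists>R. \<forall>y. T y \<le> y + vec M \<longrightarrow>
    (\<exists>D. D \<noteq> {} \<and> min_closed T D \<and> (\<forall>i\<in>D. \<forall>j. y $ i \<le> y $ j + R))"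
proof -
  \<comment> \<open>The threshold is chosen before \<open>y\<close>, while the level \<open>s\<close> at which the enlargement stops may
    depend on \<open>y\<close>.\<close>
  have step: "\<exists>t\<ge>0. \<forall>y. T y \<le> y + vec M \<longrightarrow>
      (\<exists>s\<in>{0..t}. min_closed T (near_min y s)) \<or> m \<le> card (near_min y t)" for m
  proof (induction m)
    case 0
    then show ?case by (intro exI[of _ 0]) auto
  next
    case (Suc m)
    then obtain t where t: "t \<ge> 0" "\<And>y. T y \<le> y + vec M \<Longrightarrow>
      (\<exists>s\<in>{0..t}. min_closed T (near_min y s)) \<or> m \<le> card (near_min y t)" by blast
    obtain u where u: "t \<le> u" "\<And>y. T y \<le> y + vec M \<Longrightarrow>
      min_closed T (near_min y t) \<or> near_min y t \<subset> near_min y u"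
      using near_min_grows[OF T] by blast
    have "(\<exists>s\<in>{0..u}. min_closed T (near_min y s)) \<or> Suc m \<le> card (near_min y u)"
      if y: "T y \<le> y + vec M" for y
    proof (cases "\<exists>s\<in>{0..t}. min_closed T (near_min y s)")
      case True
      then show ?thesis using u(1) by force
    next
      case False
      then have "m \<le> card (near_min y t)" and "near_min y t \<subset> near_min y u"
        using t u(2)[OF y] y by force+
      moreover from this(2) have "card (near_min y t) < card (near_min y u)"
        by (intro psubset_card_mono) auto
      ultimately show ?thesis by simp
    qed
    then show ?case using t(1) u(1) by (intro exI[of _ u]) auto
  qed
  obtain t where t: "t \<ge> 0" "\<And>y. T y \<le> y + vec M \<Longrightarrow>
    (\<exists>s\<in>{0..t}. min_closed T (near_min y s)) \<or> Suc CARD('n) \<le> card (near_min y t)"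
    using step by blast
  have "\<exists>D. D \<noteq> {} \<and> min_closed T D \<and> (\<forall>i\<in>D. \<forall>j. y $ i \<le> y $ j + t)"
    if y: "T y \<le> y + vec M" for y
  proof -
    have "card (near_min y t) \<le> CARD('n)" by (rule card_mono) auto
    then obtain s where s: "s \<in> {0..t}" "min_closed T (near_min y s)" using t(2)[OF y] by auto
    have "near_min y s \<noteq> {}" using s(1) by (intro near_min_nonempty) simp
    moreover have "\<forall>i\<in>near_min y s. \<forall>j. y $ i \<le> y $ j + t"
      using near_min_mono[of s t y] s(1) by (auto simp: near_min_def)
    ultimately show ?thesis using s(2) by blast
  qed
  then show ?thesis by blast
qed

text \<open>The set near the minimum of \<open>y\<close> for \<open>T\<close> and the set near the minimum of \<open>- y\<close> for the dual
  map have a common element \<open>i\<close>, so \<open>y $ i\<close> is within a uniform distance of both the least and the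
  greatest entry of \<open>y\<close>.\<close>

lemma slice_oscillation_bounded:
  fixes T :: "real^'n::finite \<Rightarrow> real^'n"
  assumes T: "topical T"
    and meet: "\<And>I J. I \<noteq> {} \<Longrightarrow> J \<noteq> {} \<Longrightarrow> min_closed T I \<Longrightarrow> min_closed (\<lambda>x. - T (- x)) J
      \<Longrightarrow> I \<inter> J \<noteq> {}"
  shows "\<exists>B. \<forall>y. (\<forall>i. \<bar>T y $ i - y $ i\<bar> \<le> M) \<longrightarrow> (\<forall>a b. y $ a - y $ b \<le> B)"
proof -
  let ?T = "\<lambda>x. - T (- x)"
  obtain R where R: "\<And>y. T y \<le> y + vec M \<Longrightarrow>
    \<exists>D. D \<noteq> {} \<and> min_closed T D \<and> (\<forall>i\<in>D. \<forall>j. y $ i \<le> y $ j + R)"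
    using min_closed_near_minimum[OF T] by blast
  obtain S where S: "\<And>y. ?T y \<le> y + vec M \<Longrightarrow>
    \<exists>D. D \<noteq> {} \<and> min_closed ?T D \<and> (\<forall>i\<in>D. \<forall>j. y $ i \<le> y $ j + S)"
    using min_closed_near_minimum[OF topical_dual[OF T]] by blast
  have "y $ a - y $ b \<le> R + S" if y: "\<And>i. \<bar>T y $ i - y $ i\<bar> \<le> M" for y a b
  proof -
    have "T y $ i \<le> y $ i + M" "y $ i \<le> T y $ i + M" for i using y[of i] by linarith+
    then have "T y \<le> y + vec M" "?T (- y) \<le> - y + vec M"
      by (auto simp: less_eq_vec_def algebra_simps)
    then obtain I J where IJ: "I \<noteq> {}" "min_closed T I" "\<forall>i\<in>I. \<forall>j. y $ i \<le> y $ j + R"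
      "J \<noteq> {}" "min_closed ?T J" "\<forall>i\<in>J. \<forall>j. (- y) $ i \<le> (- y) $ j + S"
      using R S by metis
    then obtain i where "i \<in> I" "i \<in> J" using meet by blast
    then have "y $ i \<le> y $ b + R" "- y $ i \<le> - y $ a + S" using IJ by auto
    then show ?thesis by simp
  qed
  then show ?thesis by blast
qed

section \<open>Existence of an additive eigenvector\<close>

text \<open>These approximate solutions exist for every topical map. The bound on \<open>e * x\<close>, uniform in \<open>e\<close>,
  is what places \<open>(1 - e) *\<^sub>R x\<close> in a slice \<open>- M \<le> T y - y \<le> M\<close> that does not depend on \<open>e\<close>.\<close>

lemma discounted_fixed_point:
  fixes T :: "real^'n::finite \<Rightarrow> real^'n"
  assumes T: "topical T" and M: "\<And>i. \<bar>T 0 $ i\<bar> \<le> M" and e: "0 < e" "e < 1"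
  shows "\<exists>x. T ((1 - e) *\<^sub>R x) = x \<and> (\<forall>i. \<bar>e * x $ i\<bar> \<le> M)"
proof -
  \<comment> \<open>The cube of half-width \<open>M / e\<close> is stable because \<open>M + (1 - e) * (M / e) = M / e\<close>.\<close>
  define C where "C = M / e"
  let ?Q = "cbox (vec (- C)) (vec C) :: (real^'n) set"
  have "0 \<le> M" using M by (meson abs_ge_zero order_trans)
  then have C: "0 \<le> C" "e * C = M" using e by (auto simp: C_def)
  have "continuous_on ?Q (T \<circ> (\<lambda>x. (1 - e) *\<^sub>R x))"
    by (intro continuous_on_compose topical_continuous T continuous_intros)
  moreover have "T \<circ> (\<lambda>x. (1 - e) *\<^sub>R x) \<in> ?Q \<rightarrow> ?Q"
  proof (simp add: Pi_iff, intro ballI)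
    fix x :: "real^'n" assume x: "x \<in> ?Q"
    then have "(1 - e) *\<^sub>R x \<le> vec ((1 - e) * C)" "vec (- ((1 - e) * C)) \<le> (1 - e) *\<^sub>R x"
      using e mult_left_mono[of _ C "1 - e"] mult_left_mono[of "- C" _ "1 - e"]
      by (auto simp: less_eq_vec_def mem_box_cart)
    from topical_mono[OF T this(1)] topical_mono[OF T this(2)]
    have up: "T ((1 - e) *\<^sub>R x) $ i \<le> T 0 $ i + (1 - e) * C"
      and low: "T 0 $ i - (1 - e) * C \<le> T ((1 - e) *\<^sub>R x) $ i" for i
      by (simp_all only: topical_const[OF T] flip: diff_conv_add_uminus)
    have "(1 - e) * C = C - M" using C by (simp add: algebra_simps)
    then show "T ((1 - e) *\<^sub>R x) \<in> ?Q"
      using up low M by (auto simp: mem_box_cart abs_le_iff) (smt (verit))+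
  qed
  moreover have "?Q \<noteq> {}" using C by (auto simp: interval_ne_empty_cart)
  ultimately obtain x where x: "x \<in> ?Q" "T ((1 - e) *\<^sub>R x) = x"
    using brouwer[OF compact_cbox convex_box(1), of "vec (- C)" "vec C" "T \<circ> (\<lambda>x. (1 - e) *\<^sub>R x)"]
    by (metis comp_apply)
  have "\<bar>e * x $ i\<bar> \<le> M" for i
  proof -
    have "\<bar>x $ i\<bar> \<le> C" using x(1) by (auto simp: mem_box_cart abs_le_iff minus_le_iff)
    then have "e * \<bar>x $ i\<bar> \<le> e * C" using e by (intro mult_left_mono) auto
    then show ?thesis using C e by (simp add: abs_mult)
  qed
  then show ?thesis using x(2) by blast
qed

definition oscillation :: "real^'n::finite \<Rightarrow> real" where
  "oscillation x = (\<Sum>i\<in>UNIV. \<Sum>j\<in>UNIV. \<bar>x $ i - x $ j\<bar>)"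

lemma oscillation_le:
  fixes x :: "real^'n::finite"
  assumes "\<And>i j. x $ i - x $ j \<le> c"
  shows "oscillation x \<le> real CARD('n) * (real CARD('n) * c)"
proof -
  have "\<bar>x $ i - x $ j\<bar> \<le> c" for i j using assms[of i j] assms[of j i] by linarith
  then have "(\<Sum>j\<in>UNIV. \<bar>x $ i - x $ j\<bar>) \<le> real CARD('n) * c" for i
    using sum_bounded_above[of UNIV "\<lambda>j. \<bar>x $ i - x $ j\<bar>" c] by simp
  then show ?thesis
    unfolding oscillation_def
    using sum_bounded_above[of UNIV "\<lambda>i. \<Sum>j\<in>UNIV. \<bar>x $ i - x $ j\<bar>" "real CARD('n) * c"] by simp
qed

lemma oscillation_zero_imp_const:
  assumes "oscillation x \<le> 0"
  shows "x $ i = x $ j"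
proof -
  have "\<bar>x $ i - x $ j\<bar> \<le> (\<Sum>j\<in>UNIV. \<bar>x $ i - x $ j\<bar>)"
    by (rule member_le_sum) auto
  also have "\<dots> \<le> oscillation x"
    unfolding oscillation_def by (rule member_le_sum) (auto intro: sum_nonneg)
  finally show ?thesis using assms by simp
qed

text \<open>By translation invariance the defect \<open>T y - y\<close> of the discounted solutions can be computed
  from the translate of \<open>y\<close> whose least entry is \<open>0\<close>.\<close>

lemma small_defect_in_box:
  fixes T :: "real^'n::finite \<Rightarrow> real^'n"
  assumes T: "topical T"
    and bd: "\<And>y. (\<forall>i. \<bar>T y $ i - y $ i\<bar> \<le> M) \<Longrightarrow> (\<forall>a b. y $ a - y $ b \<le> B)"
    and M: "\<And>i. \<bar>T 0 $ i\<bar> \<le> M" and e: "0 < e" "e < 1"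
  shows "\<exists>z\<in>cbox 0 (vec B). \<forall>a b. (T z - z) $ a - (T z - z) $ b \<le> e / (1 - e) * B"
proof -
  obtain x where x: "T ((1 - e) *\<^sub>R x) = x" "\<And>i. \<bar>e * x $ i\<bar> \<le> M"
    using discounted_fixed_point[OF T M e] by blast
  define y where "y = (1 - e) *\<^sub>R x"
  have Ty: "T y $ i - y $ i = e * x $ i" for i
    using x(1) by (simp add: y_def algebra_simps)
  then have B: "y $ a - y $ b \<le> B" for a b using bd[of y] x(2) by auto
  obtain m where m: "m \<in> near_min y 0" using near_min_nonempty[of 0 y] by auto
  define z where "z = y + vec (- y $ m)"
  have "z \<in> cbox 0 (vec B)" using m B by (auto simp: z_def mem_box_cart near_min_def)
  moreover have "(T z - z) $ a - (T z - z) $ b \<le> e / (1 - e) * B" for a b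
  proof -
    have "(T z - z) $ i = e * x $ i" for i
      using Ty[of i] topical_add_const[OF T, of y "- y $ m" i] by (simp add: z_def)
    then have "(T z - z) $ a - (T z - z) $ b = e * (x $ a - x $ b)" by (simp add: algebra_simps)
    also have "\<dots> = e / (1 - e) * (y $ a - y $ b)" using e by (simp add: y_def field_simps)
    also have "\<dots> \<le> e / (1 - e) * B" using B e by (intro mult_left_mono) auto
    finally show ?thesis .
  qed
  ultimately show ?thesis by blast
qed

text \<open>Compactness replaces a limit along a sequence \<open>e \<rightarrow> 0\<close>: a minimizer over the cube of the
  oscillation of \<open>T z - z\<close> does at least as well as every approximate solution.\<close>

lemma topical_eigenvector:
  fixes T :: "real^'n::finite \<Rightarrow> real^'n"
  assumes T: "topical T"
    and bd: "\<And>M. \<exists>B. \<forall>y. (\<forall>i. \<bar>T y $ i - y $ i\<bar> \<le> M) \<longrightarrow> (\<forall>a b. y $ a - y $ b \<le> B)"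
  shows "\<exists>z c. T z = z + vec c"
proof -
  define M where "M = norm (T 0)"
  have M: "\<bar>T 0 $ i\<bar> \<le> M" for i unfolding M_def by (rule component_le_norm_cart)
  obtain B where B: "\<And>y. (\<forall>i. \<bar>T y $ i - y $ i\<bar> \<le> M) \<Longrightarrow> (\<forall>a b. y $ a - y $ b \<le> B)"
    using bd[of M] by blast
  let ?Q = "cbox 0 (vec B) :: (real^'n) set"
  let ?g = "\<lambda>z. oscillation (T z - z)"
  let ?N = "real CARD('n) * real CARD('n)"
  have small: "\<exists>z\<in>?Q. ?g z \<le> ?N * (e / (1 - e) * B)" if e: "0 < e" "e < 1" for e
    using small_defect_in_box[OF T B M e] oscillation_le by (metis mult.assoc)
  have "?Q \<noteq> {}" using small[of "1/2"] by auto
  moreover have "continuous_on ?Q ?g"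
    unfolding oscillation_def
    by (intro continuous_intros topical_continuous T)
  ultimately obtain z where z: "z \<in> ?Q" "\<And>y. y \<in> ?Q \<Longrightarrow> ?g z \<le> ?g y"
    using continuous_attains_inf[OF compact_cbox, of 0 "vec B" ?g] by blast
  have "?g z \<le> 0"
  proof (rule tendsto_lowerbound)
    show "((\<lambda>e. ?N * (e / (1 - e) * B)) \<longlongrightarrow> 0) (at_right (0::real))"
      by (auto intro!: tendsto_eq_intros)
    have "\<forall>\<^sub>F e in at_right 0. e \<in> {0<..<(1::real)}" by (rule eventually_at_right_real) simp
    then show "\<forall>\<^sub>F e in at_right 0. ?g z \<le> ?N * (e / (1 - e) * B)"
    proof (rule eventually_mono)
      fix e :: real assume "e \<in> {0<..<1}"
      then obtain y where "y \<in> ?Q" "?g y \<le> ?N * (e / (1 - e) * B)"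
        using small[of e] by auto
      then show "?g z \<le> ?N * (e / (1 - e) * B)" using z(2) order_trans by blast
    qed
  qed simp
  then have "(T z - z) $ i = (T z - z) $ j" for i j by (rule oscillation_zero_imp_const)
  then have "T z = z + vec ((T z - z) $ undefined)"
    by (simp add: vec_eq_iff) (metis add.commute diff_add_cancel)
  then show ?thesis by blast
qed

section \<open>Logarithmic coordinates\<close>

definition log_conj :: "(real^'n \<Rightarrow> real^'n) \<Rightarrow> real^'n \<Rightarrow> real^'n" where
  "log_conj f x = (\<chi> i. ln (f (vec_exp x) $ i))"

lemma vec_exp_pos: "vec_exp x \<in> pos_orthant"
  by (simp add: vec_exp_def pos_orthant_def)

lemma monotone_homogeneous_pos:
  "monotone_homogeneous f \<Longrightarrow> x \<in> pos_orthant \<Longrightarrow> 0 < f x $ i"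
  by (auto simp: monotone_homogeneous_def pos_orthant_def image_subset_iff)

lemma exp_log_conj:
  "monotone_homogeneous f \<Longrightarrow> exp (log_conj f x $ i) = f (vec_exp x) $ i"
  by (simp add: log_conj_def monotone_homogeneous_pos vec_exp_pos)

lemma vec_exp_add_const: "vec_exp (x + vec c) = exp c *\<^sub>R vec_exp x"
  by (simp add: vec_exp_def vec_eq_iff exp_add)

lemma topical_log_conj:
  assumes f: "monotone_homogeneous f"
  shows "topical (log_conj f)"
proof -
  have "log_conj f (x + vec c) = log_conj f x + vec c" for x c
  proof -
    have "f (vec_exp (x + vec c)) = exp c *\<^sub>R f (vec_exp x)"
      using f vec_exp_pos exp_gt_zero unfolding monotone_homogeneous_def vec_exp_add_const by blast
    then show ?thesis
      using monotone_homogeneous_pos[OF f vec_exp_pos[of x]]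
      by (simp add: log_conj_def vec_eq_iff ln_mult_pos)
  qed
  moreover have "mono (log_conj f)"
  proof (rule monoI)
    fix x y :: "real^'a" assume "x \<le> y"
    then have le: "vec_exp x \<le> vec_exp y" by (simp add: less_eq_vec_def vec_exp_def)
    have "mono_on pos_orthant f" using f by (simp add: monotone_homogeneous_def)
    from mono_onD[OF this vec_exp_pos vec_exp_pos le]
    show "log_conj f x \<le> log_conj f y"
      using monotone_homogeneous_pos[OF f vec_exp_pos] by (simp add: less_eq_vec_def log_conj_def)
  qed
  ultimately show ?thesis by (simp add: topical_def)
qed

lemma min_closed_imp_min_dominion:
  fixes f :: "real^'n::finite \<Rightarrow> real^'n"
  assumes f: "monotone_homogeneous f" and "D \<noteq> {}" and c: "min_closed (log_conj f) D"
  shows "min_dominion f D"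
proof -
  have "D \<in> min_actions f i" if i: "i \<in> D" for i
  proof -
    obtain C where C: "\<forall>\<alpha>. log_conj f (\<alpha> *\<^sub>R ind_vec (- D)) $ i \<le> C"
      using bspec[OF c[unfolded min_closed_def] i] ..
    have "f (vec_exp (\<alpha> *\<^sub>R ind_vec (- D))) $ i \<le> exp C" for \<alpha>
      unfolding exp_log_conj[OF f, symmetric] using C by simp
    then show ?thesis unfolding min_actions_iff[OF f] by blast
  qed
  then show ?thesis using assms(2) by (simp add: min_dominion_iff[OF f])
qed

lemma dual_min_closed_imp_max_dominion:
  fixes f :: "real^'n::finite \<Rightarrow> real^'n"
  assumes f: "monotone_homogeneous f" and "D \<noteq> {}"
    and c: "min_closed (\<lambda>x. - log_conj f (- x)) D"
  shows "max_dominion f D"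
proof -
  have "D \<in> max_actions f i" if i: "i \<in> D" for i
  proof -
    obtain C where C: "\<forall>\<alpha>. (- log_conj f (- (\<alpha> *\<^sub>R ind_vec (- D)))) $ i \<le> C"
      using bspec[OF c[unfolded min_closed_def] i] ..
    have "exp (- C) \<le> f (vec_exp (\<alpha> *\<^sub>R ind_vec (- D))) $ i" for \<alpha>
    proof -
      have "- C \<le> log_conj f (\<alpha> *\<^sub>R ind_vec (- D)) $ i" using C[rule_format, of "- \<alpha>"] by simp
      then show ?thesis unfolding exp_log_conj[OF f, symmetric] by simp
    qed
    then show ?thesis unfolding max_actions_iff[OF f] by (intro exI[of _ "exp (- C)"]) auto
  qed
  then show ?thesis using assms(2) by (simp add: max_dominion_iff[OF f])
qed

theorem theorem1p1:
  fixes f :: "real^'n::finite \<Rightarrow> real^'n"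
  assumes "monotone_homogeneous f"
    and "\<not> (\<exists>I J. I \<inter> J = {} \<and> min_dominion f I \<and> max_dominion f J)"
  shows "\<exists>u \<in> pos_orthant. \<exists>r>0. f u = r *\<^sub>R u"
proof -
  note T = topical_log_conj[OF assms(1)]
  have "I \<inter> J \<noteq> {}" if "I \<noteq> {}" "J \<noteq> {}" "min_closed (log_conj f) I"
    "min_closed (\<lambda>x. - log_conj f (- x)) J" for I J
    using that assms(2) min_closed_imp_min_dominion[OF assms(1)]
      dual_min_closed_imp_max_dominion[OF assms(1)] by blast
  from topical_eigenvector[OF T slice_oscillation_bounded[OF T this]]
  obtain z c where z: "log_conj f z = z + vec c" by blast
  have "f (vec_exp z) $ i = (exp c *\<^sub>R vec_exp z) $ i" for i
    using exp_log_conj[OF assms(1), of z i] by (simp add: z vec_exp_def exp_add mult.commute)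
  then have "f (vec_exp z) = exp c *\<^sub>R vec_exp z" by (simp add: vec_eq_iff)
  then show ?thesis using vec_exp_pos[of z] exp_gt_zero by blast
qed

end
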